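(* Let $b>0$ and $c>0$, and let $A(b,c)>0$ and $B(b,c)>0$ be defined by $2A(b,c)^2=\sqrt{b^4+c^2}+b^2$ and $2B(b,c)^2=\sqrt{b^4+c^2}-b^2$. Then $$\int_{0}^{\infty}\eta^{3}(4ix/\pi)\,e^{-b^2 x}\sin(cx)\,dx=\frac{\pi}{4}\,\frac{\sinh(\frac{\pi}{2}A(b,c))\sin(\frac{\pi}{2}B(b,c))}{\sinh^2(\frac{\pi}{2} A(b,c))+\cos^{2}(\frac{\pi}{2}B(b,c))},$$ $$\int_{0}^{\infty}\eta^{3}(4ix/\pi)\,e^{-b^2 x}\cos(cx)\,dx=\frac{\pi}{4}\,\frac{\cosh(\frac{\pi}{2}A(b,c))\cos(\frac{\pi}{2}B(b,c))}{\cosh^2(\frac{\pi}{2} A(b,c))-\sin^{2}(\frac{\pi}{2}B(b,c))}.$$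
   Context: For real $x>0$, the Dedekind eta function is $\eta(ix)=q^{1/24}\prod_{n\ge1}(1-q^n)$ with $q=e^{-2\pi x}$; thus $\eta^3(4ix/\pi)$ denotes the cube of this function evaluated at $ix'$ with $x'=4x/\pi$. *)

theory Defs
  imports "HOL-Analysis.Analysis"
begin

text \<open>Dedekind eta on the positive imaginary axis: for real x > 0,
  eta(i x) = q^(1/24) * prod_{n>=1} (1 - q^n), with q = exp(-2 pi x).\<close>
definition eta_im :: "real \<Rightarrow> real" where
  "eta_im x = exp (- 2 * pi * x / 24) * (\<Prod>n. 1 - exp (- 2 * pi * x) ^ (Suc n))"

definition A_bc :: "real \<Rightarrow> real \<Rightarrow> real" where
  "A_bc b c = sqrt ((sqrt (b ^ 4 + c ^ 2) + b ^ 2) / 2)"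

definition B_bc :: "real \<Rightarrow> real \<Rightarrow> real" where
  "B_bc b c = sqrt ((sqrt (b ^ 4 + c ^ 2) - b ^ 2) / 2)"

end

theory Submission
  imports Defs
begin

text \<open>
  By Jacobi's identity, \<open>\<eta>\<^sup>3(4ix/\<pi>) = \<Sum> (-1)\<^sup>n (2n+1) exp (-(2n+1)\<^sup>2 x)\<close>. Integrating termwise against
  \<open>exp (-s x)\<close> with \<open>s = b\<^sup>2 - ic\<close> gives \<open>\<Sum> (-1)\<^sup>n (2n+1) / ((2n+1)\<^sup>2 + s)\<close>, the partial fraction
  expansion of \<open>(\<pi>/4) / cos (\<pi>u/2)\<close> for \<open>u\<^sup>2 = -s\<close>; with \<open>u = B + iA\<close> its real and imaginary parts are the two
  claimed values. The series is not dominated termwise, but for fixed \<open>x\<close> it alternates with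
  unimodal terms of size at most \<open>1/\<surd>x\<close>, so its partial sums are at most \<open>2/\<surd>x\<close> and dominated convergence
  applies. Jacobi's identity is the limit of a finite \<open>q\<close>-binomial identity, and the partial fractions
  come from the reflection formula of the digamma function.
\<close>

subsection \<open>Jacobi's identity for the cube of the Euler product\<close>

text \<open>This is the q-Pochhammer symbol (q;q)_n, the n-th partial product of the Euler
  product.\<close>

definition qfact :: "real \<Rightarrow> nat \<Rightarrow> real" where
  "qfact q n = (\<Prod>i<n. 1 - q ^ Suc i)"

text \<open>Setting the reciprocal to \<open>0\<close> at negative arguments keeps \<open>1/(q)\<^bsub>k-1\<^esub> = (1 - q\<^sup>k)/(q)\<^bsub>k\<^esub>\<close>
  valid for every integer \<open>k\<close>.\<close>

definition inv_qfact :: "real \<Rightarrow> int \<Rightarrow> real" where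
  "inv_qfact q k = (if k < 0 then 0 else inverse (qfact q (nat k)))"

lemma qfact_0 [simp]: "qfact q 0 = 1"
  and qfact_Suc: "qfact q (Suc n) = qfact q n * (1 - q ^ Suc n)"
  by (simp_all add: qfact_def)

lemma qfact_pos:
  assumes "0 < q" "q < 1"
  shows "qfact q n > 0"
  unfolding qfact_def using assms by (intro prod_pos) (simp add: power_Suc_less_one del: power_Suc)

lemma inv_qfact_of_nat: "inv_qfact q (int n) = inverse (qfact q n)"
  by (simp add: inv_qfact_def)

lemma inv_qfact_neg: "k < 0 \<Longrightarrow> inv_qfact q k = 0"
  by (simp add: inv_qfact_def)

lemma inv_qfact_minus_1:
  assumes "0 < q" "q < 1"
  shows "inv_qfact q (k - 1) = (1 - q powi k) * inv_qfact q k"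
proof (cases "k > 0")
  case True
  define n where "n = nat (k - 1)"
  have k: "k = int (Suc n)"
    using True by (simp add: n_def)
  have "q powi k = q ^ Suc n"
    by (simp only: k power_int_of_nat)
  moreover have "inv_qfact q (k - 1) = inverse (qfact q n)"
    by (simp add: inv_qfact_def k)
  moreover have "inv_qfact q k = inverse (qfact q n * (1 - q ^ Suc n))"
    by (simp only: k inv_qfact_of_nat qfact_Suc)
  moreover have "qfact q n > 0" "1 - q ^ Suc n > 0"
    using assms by (simp_all add: qfact_pos power_Suc_less_one del: power_Suc)
  ultimately show ?thesis
    by simp
next
  case False
  thus ?thesis
    by (cases "k = 0") (simp_all add: inv_qfact_def)
qed

text \<open>Up to the factor (q;q)_(2N+1), \<open>c N n\<close> is the q-binomial coefficient of
  2N+1 over N-n. The relation is the q-Pascal rule applied twice, from row 2N+3 down to row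
  2N+1.\<close>

lemma inv_qfact_product_recurrence:
  fixes N n :: int
  assumes q: "0 < q" "q < 1"
  defines "c \<equiv> (\<lambda>N n. inv_qfact q (N - n) * inv_qfact q (N + n + 1))"
  shows "(1 - q powi (2 * N + 2)) * (1 - q powi (2 * N + 3)) * c (N + 1) n =
           (1 + q powi (2 * N + 2)) * c N n
           + q powi (N + 1 - n) * c N (n - 1) + q powi (N + n + 2) * c N (n + 1)"
proof -
  \<comment> \<open>Every reciprocal is reduced to the two of largest index, \<open>U\<close> and
    \<open>V\<close>; the claim is then \<open>U * V\<close> times a rational identity in
    \<open>a\<close>, \<open>b\<close> and \<open>q\<close>.\<close>
  define a b where "a = q powi (N + 1 - n)" and "b = q powi (N + n + 2)"
  define U V where "U = inv_qfact q (N + 1 - n)" and "V = inv_qfact q (N + n + 2)"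
  have "q \<noteq> 0" using q by simp
  have a': "q powi (N - n) = a / q"
    using \<open>q \<noteq> 0\<close> power_int_diff[of q "N + 1 - n" 1] by (simp add: a_def)
  have b': "q powi (N + n + 1) = b / q"
    using \<open>q \<noteq> 0\<close> power_int_diff[of q "N + n + 2" 1] by (simp add: b_def add_ac)
  have ab: "q powi (2 * N + 3) = a * b"
    using \<open>q \<noteq> 0\<close> power_int_add[of q "N + 1 - n" "N + n + 2"] by (simp add: a_def b_def)
  have ab': "q powi (2 * N + 2) = a * b / q"
    using \<open>q \<noteq> 0\<close> power_int_diff[of q "2 * N + 3" 1] ab by (simp add: add_ac)
  have U1: "inv_qfact q (N - n) = (1 - a) * U"
    using inv_qfact_minus_1[OF q, of "N + 1 - n"] by (simp add: a_def U_def)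
  have U2: "inv_qfact q (N - n - 1) = (1 - a / q) * (1 - a) * U"
    using inv_qfact_minus_1[OF q, of "N - n"] by (simp add: a' U1)
  have V1: "inv_qfact q (N + n + 1) = (1 - b) * V"
    using inv_qfact_minus_1[OF q, of "N + n + 2"] by (simp add: b_def V_def add_ac)
  have V2: "inv_qfact q (N + n) = (1 - b / q) * (1 - b) * V"
    using inv_qfact_minus_1[OF q, of "N + n + 1"] b' V1 by (simp add: add_ac)
  have idx: "N + 1 + n + 1 = N + n + 2" "N - (n - 1) = N + 1 - n" "N + (n - 1) + 1 = N + n"
    "N - (n + 1) = N - n - 1" "N + (n + 1) + 1 = N + n + 2"
    by simp_all
  have c: "c (N + 1) n = U * V" "c N n = (1 - a) * U * ((1 - b) * V)"
     "c N (n - 1) = U * ((1 - b / q) * (1 - b) * V)"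
     "c N (n + 1) = (1 - a / q) * (1 - a) * U * V"
    unfolding c_def idx U1 U2 V1 V2 U_def[symmetric] V_def[symmetric] by (rule refl)+
  show ?thesis
    unfolding c ab ab' a_def[symmetric] b_def[symmetric]
    using \<open>q \<noteq> 0\<close> by (simp add: field_simps)
qed

text \<open>Summation by parts: shifting the index moves the neighbours onto the weights (2n+3) +
  (2n-1). The value \<open>- w 0\<close> stands for w(-1) under the odd extension w(-1-n) = -w(n),
  and the last two terms are the boundary at \<open>K\<close>.\<close>

lemma sum_odd_weights_neighbours:
  fixes w :: "nat \<Rightarrow> real"
  shows "(\<Sum>n\<le>K. (2 * real n + 1) * ((if n = 0 then - w 0 else w (n - 1)) + w (Suc n))) =
           2 * (\<Sum>n\<le>K. (2 * real n + 1) * w n)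
           + (2 * real K + 1) * w (Suc K) - (2 * real K + 3) * w K"
  by (induction K) (simp_all add: algebra_simps)

text \<open>The induction step multiplies by \<open>(1 - q\<^bsup>N+1\<^esup>)\<^sup>2 = 1 + q\<^bsup>2N+2\<^esup> - 2 q\<^bsup>N+1\<^esup>\<close>. The factor \<open>2\<close> acts on the
  weights as \<open>2(2n + 1) = (2n + 3) + (2n - 1)\<close>, which shifts \<open>n\<close> and matches the two neighbours in
  the recurrence for the \<open>q\<close>-binomials; at \<open>n = 0\<close> the odd symmetry \<open>n \<mapsto> -1 - n\<close> closes the sum.\<close>

lemma finite_jacobi:
  assumes q: "0 < q" "q < 1"
  shows "(\<Sum>n\<le>N. (-1) ^ n * (2 * real n + 1) * q ^ (n * (n + 1) div 2)
            * (inv_qfact q (int N - int n) * inv_qfact q (int N + int n + 1)))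
         = qfact q N ^ 2 / qfact q (2 * N + 1)"
proof (induction N)
  case 0
  have "inv_qfact q 1 = inverse (1 - q)" "inv_qfact q 0 = 1"
    by (simp_all add: inv_qfact_def qfact_def)
  thus ?case
    by (simp add: qfact_def field_simps)
next
  case (Suc N)
  define T where "T n = n * (n + 1) div 2" for n :: nat
  define c where "c = (\<lambda>N n. inv_qfact q (N - n) * inv_qfact q (N + n + 1))"
  define w where "w n = (-1) ^ n * q ^ T n * c (int N) (int n)" for n
  define p where "p n = (if n = 0 then - w 0 else w (n - 1))" for n
  have "q \<noteq> 0" using q by simp
  have T_Suc: "T (Suc n) = T n + Suc n" for n
    by (simp add: T_def)
  \<comment> \<open>The triangular exponents absorb the powers of \<open>q\<close> that depend on
    \<open>n\<close>: T(n) + (N+n+2) = (N+1) + T(n+1) and T(n) + (N+1-n) = (N+1) + T(n-1). Both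
    neighbours thus carry the same factor -q^(N+1).\<close>
  have rec: "(1 - q ^ (2 * N + 2)) * (1 - q ^ (2 * N + 3)) * ((-1) ^ n * q ^ T n * c (int (Suc N)) (int n))
     = (1 + q ^ (2 * N + 2)) * w n - q ^ Suc N * (p n + w (Suc n))" for n
  proof -
    have pw: "q powi (2 * int N + 2) = q ^ (2 * N + 2)" "q powi (2 * int N + 3) = q ^ (2 * N + 3)"
      by (simp_all flip: power_int_of_nat add: algebra_simps)
    have rec_c: "(1 - q powi (2 * int N + 2)) * (1 - q powi (2 * int N + 3)) * c (int N + 1) (int n) =
           (1 + q powi (2 * int N + 2)) * c (int N) (int n)
           + q powi (int N + 1 - int n) * c (int N) (int n - 1)
           + q powi (int N + int n + 2) * c (int N) (int n + 1)"
      unfolding c_def by (rule inv_qfact_product_recurrence[OF q])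
    have 1: "q ^ T n * q powi (int N + int n + 2) = q ^ Suc N * q ^ T (Suc n)"
      using power_int_of_nat[of q "N + n + 2"] by (simp add: T_Suc power_add algebra_simps)
    have 2: "(-1) ^ n * q ^ T n * (q powi (int N + 1 - int n) * c (int N) (int n - 1)) = - (q ^ Suc N * p n)"
    proof (cases n)
      \<comment> \<open>The left neighbour has index -1 here, and \<open>c N (-1) = c N 0\<close>
        because the two reciprocals swap.\<close>
      case 0
      have "q powi (int N + 1) = q ^ Suc N"
        using power_int_of_nat[of q "Suc N"] by (simp add: algebra_simps)
      thus ?thesis
        by (simp add: 0 p_def w_def c_def T_def)
    next
      case (Suc m)
      have "q ^ T n * q powi (int N + 1 - int n) = q ^ T m * (q powi (int n) * q powi (int N + 1 - int n))"
        by (simp add: Suc T_Suc power_add power_int_of_nat del: of_nat_Suc)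
      also have "q powi (int n) * q powi (int N + 1 - int n) = q powi (int (Suc N))"
        using \<open>q \<noteq> 0\<close> power_int_add[of q "int n" "int N + 1 - int n"] by (simp add: add_ac)
      finally have "q ^ T n * q powi (int N + 1 - int n) = q ^ T m * q ^ Suc N"
        by (simp only: power_int_of_nat)
      moreover have "(-1) ^ n = - ((-1) ^ m :: real)"
        by (simp add: Suc)
      ultimately show ?thesis
        by (simp add: p_def w_def Suc mult_ac)
    qed
    have "(1 - q ^ (2 * N + 2)) * (1 - q ^ (2 * N + 3)) * ((-1) ^ n * q ^ T n * c (int (Suc N)) (int n))
      = (-1) ^ n * q ^ T n * ((1 - q powi (2 * int N + 2)) * (1 - q powi (2 * int N + 3)) * c (int N + 1) (int n))"
      unfolding pw by (simp only: of_nat_Suc mult_ac add_ac)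
    also have "\<dots> = (1 + q ^ (2 * N + 2)) * w n
       + (-1) ^ n * q ^ T n * (q powi (int N + 1 - int n) * c (int N) (int n - 1))
       + (-1) ^ n * (q ^ T n * q powi (int N + int n + 2)) * c (int N) (int n + 1)"
      unfolding rec_c unfolding pw w_def by (simp only: ring_distribs mult_ac mult_1_left)
    also have "\<dots> = (1 + q ^ (2 * N + 2)) * w n - q ^ Suc N * (p n + w (Suc n))"
      unfolding 1 2 by (simp add: w_def algebra_simps)
    finally show ?thesis .
  qed
  have pow2: "q ^ (2 * N + 2) = q ^ Suc N * q ^ Suc N"
    by (simp add: mult_2 power_add)
  \<comment> \<open>This extends the sum from \<open>N\<close> to \<open>Suc N\<close> and kills
    both boundary terms of the summation by parts.\<close>
  have w0: "w n = 0" if "n > N" for n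
    using that by (simp add: w_def c_def inv_qfact_neg)
  have S: "(\<Sum>n\<le>Suc N. (2 * real n + 1) * w n) = qfact q N ^ 2 / qfact q (2 * N + 1)"
    using Suc.IH by (simp add: w_def c_def T_def mult_ac inv_qfact_neg)
  have "(1 - q ^ (2 * N + 2)) * (1 - q ^ (2 * N + 3)) *
      (\<Sum>n\<le>Suc N. (2 * real n + 1) * ((-1) ^ n * q ^ T n * c (int (Suc N)) (int n)))
    = (\<Sum>n\<le>Suc N. (2 * real n + 1) * ((1 - q ^ (2 * N + 2)) * (1 - q ^ (2 * N + 3)) * ((-1) ^ n * q ^ T n * c (int (Suc N)) (int n))))"
    unfolding sum_distrib_left by (intro sum.cong refl) (simp only: mult_ac)
  also have "\<dots> = (\<Sum>n\<le>Suc N. (1 + q ^ (2 * N + 2)) * ((2 * real n + 1) * w n)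
       - q ^ Suc N * ((2 * real n + 1) * (p n + w (Suc n))))"
    unfolding rec by (intro sum.cong refl) (simp only: ring_distribs mult_ac)
  also have "\<dots> = (1 + q ^ (2 * N + 2)) * (\<Sum>n\<le>Suc N. (2 * real n + 1) * w n)
       - q ^ Suc N * (\<Sum>n\<le>Suc N. (2 * real n + 1) * (p n + w (Suc n)))"
    by (simp only: sum_subtractf sum_distrib_left)
  also have "(\<Sum>n\<le>Suc N. (2 * real n + 1) * (p n + w (Suc n))) = 2 * (\<Sum>n\<le>Suc N. (2 * real n + 1) * w n)"
    unfolding p_def sum_odd_weights_neighbours by (simp add: w0)
  also have "(1 + q ^ (2 * N + 2)) * (\<Sum>n\<le>Suc N. (2 * real n + 1) * w n)
       - q ^ Suc N * (2 * (\<Sum>n\<le>Suc N. (2 * real n + 1) * w n)) =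
       (1 - q ^ Suc N) ^ 2 * (\<Sum>n\<le>Suc N. (2 * real n + 1) * w n)"
    by (simp only: pow2) (simp add: power2_eq_square algebra_simps)
  also have "\<dots> = qfact q (Suc N) ^ 2 / qfact q (2 * N + 1)"
    unfolding S by (simp only: qfact_Suc power_mult_distrib times_divide_eq_right mult_ac)
  finally have eq: "(1 - q ^ (2 * N + 2)) * (1 - q ^ (2 * N + 3)) *
      (\<Sum>n\<le>Suc N. (2 * real n + 1) * ((-1) ^ n * q ^ T n * c (int (Suc N)) (int n))) = \<dots>" .
  have "2 * Suc N + 1 = Suc (Suc (2 * N + 1))" by simp
  hence Q: "qfact q (2 * Suc N + 1) = qfact q (2 * N + 1) * ((1 - q ^ (2 * N + 2)) * (1 - q ^ (2 * N + 3)))"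
    by (simp only: qfact_Suc) (simp add: numeral_3_eq_3)
  have "1 - q ^ (2 * N + 2) > 0" "1 - q ^ (2 * N + 3) > 0"
    using q power_Suc_less_one[of q "2 * N + 1"] power_Suc_less_one[of q "2 * N + 2"]
    by (simp_all add: eval_nat_numeral)
  moreover have "s = x / (d * (u * v))" if "u > 0" "v > 0" "u * v * s = x / d" for u v s x d :: real
    using that by (metis divide_divide_eq_left less_numeral_extra(3) mult_eq_0_iff nonzero_mult_div_cancel_left)
  ultimately have "(\<Sum>n\<le>Suc N. (2 * real n + 1) * ((-1) ^ n * q ^ T n * c (int (Suc N)) (int n)))
     = qfact q (Suc N) ^ 2 / qfact q (2 * Suc N + 1)"
    unfolding Q using eq by blast
  thus ?case
    unfolding c_def T_def by (simp only: mult_ac)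
qed

text \<open>All factors lie in (0,1), so the partial products decrease, and the absolutely
  convergent product has no zero factor. The bound from below makes \<open>inverse P\<close> a
  uniform bound for all the reciprocals.\<close>

lemma qfact_tendsto_prodinf:
  assumes q: "0 < q" "q < 1"
  defines "P \<equiv> (\<Prod>n. 1 - q ^ Suc n)"
  shows "qfact q \<longlonglongrightarrow> P" and "P > 0" and "P \<le> qfact q n"
proof -
  have "summable (\<lambda>n. norm ((1 - q ^ Suc n) - 1))"
    using q by (simp add: abs_mult summable_mult power_abs)
  hence conv: "convergent_prod (\<lambda>n. 1 - q ^ Suc n)"
    by (intro abs_convergent_prod_imp_convergent_prod) (simp only: abs_convergent_prod_conv_summable)
  have "(\<lambda>n. qfact q (Suc n)) \<longlonglongrightarrow> P"
    using convergent_prod_LIMSEQ[OF conv] by (simp add: P_def qfact_def lessThan_Suc_atMost)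
  thus lim: "qfact q \<longlonglongrightarrow> P"
    by (subst (asm) filterlim_sequentially_Suc)
  have "decseq (qfact q)"
    using q qfact_pos[OF q] 
    by (intro decseq_SucI) (auto simp: qfact_Suc mult_le_cancel_left1 less_imp_le simp del: power_Suc
       intro!: mult_left_le)
  thus le: "P \<le> qfact q n" for n
    using lim by (rule decseq_ge)
  have "P \<noteq> 0"
    unfolding P_def using q
    by (intro prodinf_nonzero conv) (simp add: power_less_one_iff del: power_Suc, metis less_irrefl power_Suc_less_one)
  moreover have "P \<ge> 0"
    using lim qfact_pos[OF q] by (intro LIMSEQ_le_const) (auto intro: less_imp_le)
  ultimately show "P > 0" by simp
qed

text \<open>Let N tend to infinity in \<open>finite_jacobi\<close>: both reciprocals tend to 1/P and
  the right side to P^2/P, so the series over P^2 equals P. Tannery's theorem justifies the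
  exchange.\<close>

theorem jacobi_identity:
  assumes q: "0 < q" "q < 1"
  shows "(\<lambda>n. (-1) ^ n * (2 * real n + 1) * q ^ (n * (n + 1) div 2)) sums (\<Prod>n. 1 - q ^ Suc n) ^ 3"
proof -
  define P where "P = (\<Prod>n. 1 - q ^ Suc n)"
  define t where "t n = (-1) ^ n * (2 * real n + 1) * q ^ (n * (n + 1) div 2)" for n
  define a where "a n N = t n * (inv_qfact q (int N - int n) * inv_qfact q (int N + int n + 1))" for n N
  have P: "qfact q \<longlonglongrightarrow> P" "P > 0" "\<And>n. P \<le> qfact q n"
    using qfact_tendsto_prodinf[OF q] by (simp_all add: P_def)
  have inv_bound: "0 \<le> inv_qfact q k \<and> inv_qfact q k \<le> inverse P" for k
    using P(2,3) qfact_pos[OF q] by (auto simp: inv_qfact_def intro: less_imp_le le_imp_inverse_le)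
  have "summable (\<lambda>n. 2 * (of_nat (Suc n) * q ^ n))"
    using geometric_deriv_sums[of q] q by (intro summable_mult) (auto simp: sums_iff)
  hence "summable (\<lambda>n. norm (t n))"
  proof (rule summable_comparison_test[rotated], intro exI[of _ 0] allI impI)
    fix n :: nat
    \<comment> \<open>Triangular numbers are at least \<open>n\<close>, so the series is dominated
      by the differentiated geometric series.\<close>
    have "n * 2 \<le> n * (n + 1)" if "n > 0" using that by (intro mult_left_mono) auto
    hence "n \<le> n * (n + 1) div 2" by (simp only: less_eq_div_iff_mult_less_eq zero_less_numeral) auto
    hence "q ^ (n * (n + 1) div 2) \<le> q ^ n" using q by (intro power_decreasing) auto
    hence "(2 * real n + 1) * q ^ (n * (n + 1) div 2) \<le> (2 * real (Suc n)) * q ^ n"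
      using q by (intro mult_mono) auto
    moreover have "norm (t n) = (2 * real n + 1) * q ^ (n * (n + 1) div 2)"
      using q by (simp add: t_def abs_mult)
    ultimately show "norm (norm (t n)) \<le> 2 * (of_nat (Suc n) * q ^ n)"
      using q by (simp only: mult.assoc real_norm_def abs_idempotent)
  qed
  hence summable: "summable (\<lambda>n. norm (t n) * (inverse P * inverse P))"
    by (rule summable_mult2)
  have bound: "norm (a n N) \<le> norm (t n) * (inverse P * inverse P)" for n N
    unfolding a_def norm_mult using inv_bound P(2) by (intro mult_left_mono mult_mono) auto
  have lim: "(\<lambda>N. a n N) \<longlonglongrightarrow> t n * (inverse P * inverse P)" for n
  proof -
    have inv: "(\<lambda>N. inverse (qfact q N)) \<longlonglongrightarrow> inverse P"
      using P by (intro tendsto_inverse) auto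
    \<comment> \<open>Shifting \<open>N\<close> by \<open>n\<close> keeps the argument nonnegative,
      away from the zero values of \<open>inv_qfact\<close>.\<close>
    have "(\<lambda>N. inv_qfact q (int (N + n) - int n)) \<longlonglongrightarrow> inverse P"
      using inv by (simp add: inv_qfact_of_nat)
    hence 1: "(\<lambda>N. inv_qfact q (int N - int n)) \<longlonglongrightarrow> inverse P"
      by (rule LIMSEQ_offset)
    have "inv_qfact q (int N + int n + 1) = inverse (qfact q (N + (n + 1)))" for N
      using inv_qfact_of_nat[of q "N + (n + 1)"] by (simp add: algebra_simps)
    hence 2: "(\<lambda>N. inv_qfact q (int N + int n + 1)) \<longlonglongrightarrow> inverse P"
      using LIMSEQ_ignore_initial_segment[OF inv, of "n + 1"] by simp
    show ?thesis unfolding a_def by (intro tendsto_intros 1 2)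
  qed
  have ev: "eventually (\<lambda>(n, N). norm (a n N) \<le> norm (t n) * (inverse P * inverse P)) (sequentially \<times>\<^sub>F sequentially)"
    by (intro always_eventually) (auto simp only: split_def intro: bound)
  have "(\<lambda>N. \<Sum>n. a n N) \<longlonglongrightarrow> (\<Sum>n. t n * (inverse P * inverse P))"
    and sm: "summable (\<lambda>n. norm (t n * (inverse P * inverse P)))"
    using tannerys_theorem[where a = a and b = "\<lambda>n. t n * (inverse P * inverse P)" and F = sequentially, OF lim ev summable]
    by auto
  moreover have "(\<Sum>n. a n N) = qfact q N ^ 2 / qfact q (2 * N + 1)" for N
  proof -
    have "(\<Sum>n. a n N) = (\<Sum>n\<le>N. a n N)"
      by (rule suminf_finite) (auto simp: a_def inv_qfact_neg)
    thus ?thesis unfolding a_def t_def finite_jacobi[OF q] .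
  qed
  ultimately have "(\<lambda>N. qfact q N ^ 2 / qfact q (2 * N + 1)) \<longlonglongrightarrow> (\<Sum>n. t n * (inverse P * inverse P))"
    by simp
  moreover have "(\<lambda>N. qfact q (2 * N + 1)) \<longlonglongrightarrow> P"
    using P(1) by (rule filterlim_compose) (rule filterlim_subseq, simp add: strict_mono_def)
  hence "(\<lambda>N. qfact q N ^ 2 / qfact q (2 * N + 1)) \<longlonglongrightarrow> P ^ 2 / P"
    using P by (intro tendsto_intros) auto
  ultimately have "(\<Sum>n. t n * (inverse P * inverse P)) = P ^ 2 / P"
    by (rule LIMSEQ_unique)
  hence "(\<lambda>n. t n * (inverse P * inverse P)) sums (P ^ 2 / P)"
    using sm summable_norm_cancel summable_sums by metis
  hence "(\<lambda>n. t n * (inverse P * inverse P) * P ^ 2) sums (P ^ 2 / P * P ^ 2)"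
    by (rule sums_mult2)
  moreover have "t n * (inverse P * inverse P) * P ^ 2 = t n" for n
    using P(2) by (simp add: power2_eq_square field_simps)
  moreover have "P ^ 2 / P * P ^ 2 = P ^ 3"
    using P(2) by (simp add: power2_eq_square power3_eq_cube)
  ultimately have "t sums P ^ 3" by simp
  thus ?thesis unfolding t_def P_def .
qed

text \<open>At 4x/pi the nome is exp(-8x) and the cubed prefactor is exp(-x); the exponents combine
  by 1 + 8 n(n+1)/2 = (2n+1)^2.\<close>

lemma eta_im_cubed_sums:
  assumes "x > 0"
  shows "(\<lambda>n. (-1) ^ n * (2 * real n + 1) * exp (- (2 * real n + 1)\<^sup>2 * x)) sums eta_im (4 * x / pi) ^ 3"
proof -
  define q where "q = exp (- (8 * x))"
  have q: "0 < q" "q < 1"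
    using assms by (simp_all add: q_def)
  have "exp (- x) * q ^ (n * (n + 1) div 2) = exp (- (2 * real n + 1)\<^sup>2 * x)" for n
  proof -
    have "real (n * (n + 1) div 2) = real n * (real n + 1) / 2"
      by (simp add: real_of_nat_div algebra_simps)
    thus ?thesis
      by (simp only: q_def flip: exp_of_nat_mult exp_add) (simp add: power2_eq_square field_simps)
  qed
  hence *: "exp (- x) * ((-1) ^ n * (2 * real n + 1) * q ^ (n * (n + 1) div 2)) =
         (-1) ^ n * (2 * real n + 1) * exp (- (2 * real n + 1)\<^sup>2 * x)" for n
    by (metis mult.left_commute)
  have "eta_im (4 * x / pi) = exp (- x / 3) * (\<Prod>n. 1 - q ^ Suc n)"
    by (simp add: eta_im_def q_def mult_ac)
  moreover have "exp (- x / 3) ^ 3 = exp (- x)"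
    by (simp flip: exp_of_nat_mult)
  ultimately have "eta_im (4 * x / pi) ^ 3 = exp (- x) * (\<Prod>n. 1 - q ^ Suc n) ^ 3"
    by (simp only: power_mult_distrib)
  thus ?thesis
    using sums_mult[OF jacobi_identity[OF q], of "exp (- x)"] unfolding * by simp
qed

subsection \<open>Bounds for the partial sums\<close>

text \<open>Removing the first term leaves minus the same kind of sum for the shifted sequence,
  hence the induction with \<open>a\<close> arbitrary.\<close>

lemma alternating_sum_decreasing:
  fixes a :: "nat \<Rightarrow> real"
  assumes "\<And>n. 0 \<le> a n" "\<And>n. a (Suc n) \<le> a n"
  shows "0 \<le> (\<Sum>n<N. (-1) ^ n * a n)" and "(\<Sum>n<N. (-1) ^ n * a n) \<le> a 0"
proof -
  have "0 \<le> (\<Sum>n<N. (-1) ^ n * a n) \<and> (\<Sum>n<N. (-1) ^ n * a n) \<le> a 0"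
    using assms
  proof (induction N arbitrary: a)
    case (Suc N)
    have "(\<Sum>n<Suc N. (-1) ^ n * a n) = a 0 - (\<Sum>n<N. (-1) ^ n * a (Suc n))"
      by (simp add: sum.lessThan_Suc_shift sum_negf del: sum.lessThan_Suc)
    thus ?case
      using Suc.IH[of "\<lambda>n. a (Suc n)"] Suc.prems(1)[of 0] Suc.prems by (smt (verit))
  qed auto
  thus "0 \<le> (\<Sum>n<N. (-1) ^ n * a n)" and "(\<Sum>n<N. (-1) ^ n * a n) \<le> a 0"
    by auto
qed

text \<open>The mirror image: the last term is split off, and the factor (-1)^N makes its sign
  positive.\<close>

lemma alternating_sum_increasing:
  fixes a :: "nat \<Rightarrow> real"
  assumes "\<And>n. 0 \<le> a n" "\<And>n. n < N \<Longrightarrow> a n \<le> a (Suc n)"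
  shows "\<bar>\<Sum>n\<le>N. (-1) ^ n * a n\<bar> \<le> a N"
proof -
  have "0 \<le> (-1) ^ N * (\<Sum>n\<le>N. (-1) ^ n * a n) \<and> (-1) ^ N * (\<Sum>n\<le>N. (-1) ^ n * a n) \<le> a N"
    using assms(2)
  proof (induction N)
    case (Suc N)
    have "(-1) ^ Suc N * (\<Sum>n\<le>Suc N. (-1) ^ n * a n) = a (Suc N) - (-1) ^ N * (\<Sum>n\<le>N. (-1) ^ n * a n)"
      by (simp add: algebra_simps flip: power_mult_distrib)
    thus ?case
      using Suc.IH Suc.prems[of N] Suc.prems by (smt (verit) lessI less_SucI)
  qed (use assms in auto)
  hence "\<bar>(-1) ^ N * (\<Sum>n\<le>N. (-1) ^ n * a n)\<bar> \<le> a N"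
    by linarith
  thus ?thesis
    by (simp add: abs_mult)
qed

text \<open>The sum is cut at \<open>m\<close>: the rising part is bounded by its last term, the
  falling part by its first. The order of \<open>a (m - 1)\<close> and \<open>a m\<close> is left
  open because the peak of a sampled function may lie between them.\<close>

lemma alternating_sum_unimodal:
  fixes a :: "nat \<Rightarrow> real"
  assumes nonneg: "\<And>n. 0 \<le> a n" and le: "\<And>n. a n \<le> M"
    and incr: "\<And>n. Suc n < m \<Longrightarrow> a n \<le> a (Suc n)"
    and decr: "\<And>n. n \<ge> m \<Longrightarrow> a (Suc n) \<le> a n"
  shows "\<bar>\<Sum>n<N. (-1) ^ n * a n\<bar> \<le> 2 * M"
proof -
  have M: "0 \<le> M" using nonneg[of 0] le[of 0] by linarith
  have initial: "\<bar>\<Sum>n<k. (-1) ^ n * a n\<bar> \<le> M" if "k \<le> m" for k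
  proof (cases k)
    case (Suc l)
    have "\<bar>\<Sum>n\<le>l. (-1) ^ n * a n\<bar> \<le> a l"
      using that Suc by (intro alternating_sum_increasing nonneg incr) auto
    thus ?thesis using le[of l] by (simp add: Suc lessThan_Suc_atMost)
  qed (use M in auto)
  show ?thesis
  proof (cases "N \<le> m")
    case True
    thus ?thesis using initial[of N] M by linarith
  next
    case False
    then obtain k where N: "N = m + k" using le_Suc_ex nat_le_linear by blast
    have "(\<Sum>n<N. (-1) ^ n * a n) = (\<Sum>n<m. (-1) ^ n * a n) + (\<Sum>n<k. (-1) ^ (m + n) * a (m + n))"
      unfolding N by (induction k) (simp_all add: algebra_simps)
    also have "(\<Sum>n<k. (-1) ^ (m + n) * a (m + n)) = (-1) ^ m * (\<Sum>n<k. (-1) ^ n * a (m + n))"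
      by (simp add: sum_distrib_left power_add mult.assoc)
    finally have "\<bar>\<Sum>n<N. (-1) ^ n * a n\<bar> \<le>
        \<bar>\<Sum>n<m. (-1) ^ n * a n\<bar> + \<bar>(-1) ^ m * (\<Sum>n<k. (-1) ^ n * a (m + n))\<bar>"
      by (metis abs_triangle_ineq)
    moreover have "\<bar>(-1) ^ m * (\<Sum>n<k. (-1) ^ n * a (m + n))\<bar> \<le> M"
      using alternating_sum_decreasing[of "\<lambda>n. a (m + n)" k] nonneg decr le[of m]
      by (simp add: abs_mult)
    ultimately show ?thesis using initial[of m] by linarith
  qed
qed

text \<open>With y = t sqrt x this is y <= 1 + y^2 <= exp(y^2).\<close>

lemma gaussian_moment_bound:
  fixes t x :: real
  assumes "x > 0" "t \<ge> 0"
  shows "t * exp (- t\<^sup>2 * x) \<le> 1 / sqrt x"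
proof -
  have "t * sqrt x \<le> 1 + (t * sqrt x)\<^sup>2"
    using sum_squares_bound[of 1 "t * sqrt x"] zero_le_power2[of "t * sqrt x"] unfolding one_power2 mult_1_right by linarith
  also have "\<dots> = 1 + t\<^sup>2 * x" using assms by (simp add: power_mult_distrib)
  also have "\<dots> \<le> exp (t\<^sup>2 * x)" by (rule exp_ge_add_one_self)
  finally show ?thesis
    using assms by (simp add: exp_minus field_simps)
qed

text \<open>The function t exp(-t^2 x) rises until 2 t^2 x = 1 and falls afterwards, so its values
  at the odd numbers are unimodal.\<close>

lemma theta_partial_sum_bound:
  fixes x :: real
  assumes x: "x > 0"
  shows "\<bar>\<Sum>n<N. (-1) ^ n * (2 * real n + 1) * exp (- (2 * real n + 1)\<^sup>2 * x)\<bar> \<le> 2 / sqrt x"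
proof -
  define f where "f t = t * exp (- t\<^sup>2 * x)" for t
  have deriv: "(f has_real_derivative (1 - 2 * t\<^sup>2 * x) * exp (- t\<^sup>2 * x)) (at t)" for t
    unfolding f_def by (auto intro!: derivative_eq_intros simp: power2_eq_square algebra_simps)
  have incr: "f s \<le> f t" if "0 \<le> s" "s \<le> t" "2 * t\<^sup>2 * x \<le> 1" for s t
  proof (rule DERIV_nonneg_imp_nondecreasing[OF \<open>s \<le> t\<close>])
    fix y assume y: "s \<le> y" "y \<le> t"
    have "2 * y\<^sup>2 * x \<le> 2 * t\<^sup>2 * x"
      using x y that by (intro mult_right_mono mult_left_mono power_mono) auto
    thus "\<exists>d. (f has_real_derivative d) (at y) \<and> 0 \<le> d"
      using that by (intro exI[of _ "(1 - 2 * y\<^sup>2 * x) * exp (- y\<^sup>2 * x)"] conjI deriv) simp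
  qed
  have decr: "f t \<le> f s" if "0 \<le> s" "s \<le> t" "2 * s\<^sup>2 * x \<ge> 1" for s t
  proof (rule DERIV_nonpos_imp_nonincreasing[OF \<open>s \<le> t\<close>])
    fix y assume y: "s \<le> y" "y \<le> t"
    have "2 * s\<^sup>2 * x \<le> 2 * y\<^sup>2 * x"
      using x y that by (intro mult_right_mono mult_left_mono power_mono) auto
    thus "\<exists>d. (f has_real_derivative d) (at y) \<and> d \<le> 0"
      using that by (intro exI[of _ "(1 - 2 * y\<^sup>2 * x) * exp (- y\<^sup>2 * x)"] conjI deriv) (simp add: mult_le_0_iff)
  qed
  define m where "m = (LEAST n. 1 \<le> 2 * (2 * real n + 1)\<^sup>2 * x)"
  \<comment> \<open>Any k > 1/x witnesses that the defining set of \<open>m\<close> is nonempty, as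
    2(2k+1)^2 exceeds k.\<close>
  obtain k :: nat where k: "real k > 1 / x"
    using reals_Archimedean2 by blast
  have "1 / x \<le> 2 * (2 * real k + 1)\<^sup>2"
    using k by (auto simp: power2_eq_square algebra_simps intro: order_trans[OF less_imp_le])
  hence "1 \<le> 2 * (2 * real k + 1)\<^sup>2 * x"
    using x by (simp add: field_simps)
  hence m: "1 \<le> 2 * (2 * real m + 1)\<^sup>2 * x"
    unfolding m_def by (rule LeastI)
  have "\<bar>\<Sum>n<N. (-1) ^ n * f (2 * real n + 1)\<bar> \<le> 2 * (1 / sqrt x)"
  proof (rule alternating_sum_unimodal[where m = m])
    show "f (2 * real n + 1) \<le> 1 / sqrt x" for n
      unfolding f_def by (rule gaussian_moment_bound) (use x in auto)
    show "f (2 * real n + 1) \<le> f (2 * real (Suc n) + 1)" if "Suc n < m" for n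
      using not_less_Least[OF that[unfolded m_def]] by (intro incr) auto
    show "f (2 * real (Suc n) + 1) \<le> f (2 * real n + 1)" if "n \<ge> m" for n
    proof (rule decr)
      have "2 * (2 * real m + 1)\<^sup>2 * x \<le> 2 * (2 * real n + 1)\<^sup>2 * x"
        using x that by (intro mult_right_mono mult_left_mono power_mono) auto
      thus "1 \<le> 2 * (2 * real n + 1)\<^sup>2 * x" using m by linarith
    qed auto
  qed (simp add: f_def)
  thus ?thesis by (simp add: f_def mult.assoc)
qed

subsection \<open>Laplace transform\<close>

text \<open>This is the Gamma integrand at 1/2, rescaled by \<open>a\<close>; twice it, with a = Re
  s, will dominate the partial sums.\<close>

lemma inverse_sqrt_exp_integrable:
  fixes a :: real
  assumes "a > 0"
  shows "(\<lambda>x. exp (- a * x) / sqrt x) integrable_on {0<..}"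
proof -
  have "(\<lambda>t. norm (complex_of_real t powr (1/2 - 1) / of_real (exp (a * t)))) integrable_on {0<..}"
    using absolutely_integrable_Gamma_integral[of "1/2" a] assms
    by (simp add: absolutely_integrable_on_def)
  also have "?this \<longleftrightarrow> ?thesis"
  proof (rule integrable_cong)
    fix t :: real assume "t \<in> {0<..}"
    thus "norm (complex_of_real t powr (1/2 - 1) / of_real (exp (a * t))) = exp (- a * t) / sqrt t"
      by (simp add: norm_divide norm_powr_real_powr norm_mult powr_minus exp_minus powr_half_sqrt field_simps)
  qed
  finally show ?thesis .
qed

text \<open>An antiderivative gives the integral over [0,k]; dominated convergence with bound
  exp(-Re s x) gives the limit, since exp(-s) has modulus below 1.\<close>

lemma has_integral_exp_minus_complex:
  fixes s :: complex
  assumes s: "Re s > 0"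
  shows "((\<lambda>x. exp (- s * of_real x)) has_integral 1 / s) {0<..}"
proof -
  have "s \<noteq> 0" using s by auto
  have "((\<lambda>x. exp (- s * of_real x)) has_integral 1 / s) {0..}"
  proof (rule has_integral_dominated_convergence)
    show "((\<lambda>x. if x \<in> {0..real k} then exp (- s * of_real x) else 0) has_integral
             (1 - exp (- s) ^ k) / s) {0..}" for k
    proof -
      have "((\<lambda>x. exp (- s * of_real x)) has_integral
              (- exp (- s * of_real (real k)) / s - (- exp (- s * of_real 0) / s))) {0..real k}"
      proof (rule fundamental_theorem_of_calculus)
        fix x :: real
        have "((\<lambda>w. - exp (- s * w) / s) has_field_derivative exp (- s * of_real x)) (at (of_real x))"
          using \<open>s \<noteq> 0\<close> by (auto intro!: derivative_eq_intros)
        thus "((\<lambda>x. - exp (- s * of_real x) / s) has_vector_derivative exp (- s * of_real x))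
                (at x within {0..real k})"
          by (rule has_vector_derivative_real_field)
      qed auto
      also have "- exp (- s * of_real (real k)) / s - (- exp (- s * of_real 0) / s) = (1 - exp (- s) ^ k) / s"
        by (simp add: diff_divide_distrib mult.commute flip: exp_of_nat_mult)
      finally show ?thesis
        by (subst has_integral_restrict) auto
    qed
    show "(\<lambda>x. exp (- Re s * x)) integrable_on {0..}"
      using has_integral_exp_minus_to_infinity[OF s, of 0] by blast
    show "\<forall>x\<in>{0..}. norm (if x \<in> {0..real k} then exp (- s * of_real x) else 0) \<le> exp (- Re s * x)" for k
      by simp
    show "\<forall>x\<in>{0..}. (\<lambda>k. if x \<in> {0..real k} then exp (- s * of_real x) else 0) \<longlonglongrightarrow> exp (- s * of_real x)"
    proof
      fix x :: real assume "x \<in> {0..}"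
      moreover have "\<forall>\<^sub>F k in sequentially. x \<le> real k"
        using filterlim_real_sequentially by (simp add: filterlim_at_top)
      ultimately show "(\<lambda>k. if x \<in> {0..real k} then exp (- s * of_real x) else 0) \<longlonglongrightarrow> exp (- s * of_real x)"
        by (intro tendsto_eventually) (auto elim!: eventually_mono)
    qed
    have "(\<lambda>k. (1 - exp (- s) ^ k) / s) \<longlonglongrightarrow> (1 - 0) / s"
      using s \<open>s \<noteq> 0\<close> by (intro tendsto_intros LIMSEQ_power_zero) auto
    thus "(\<lambda>k. (1 - exp (- s) ^ k) / s) \<longlonglongrightarrow> 1 / s" by simp
  qed
  thus ?thesis
    by (rule has_integral_spike_set_eq[THEN iffD1, rotated 2]) (rule negligible_subset[of "{0}"]; auto)+
qed

section \<open>Partial fractions of the secant\<close>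

text \<open>Differentiate rGamma(z) rGamma(1-z) = sin(pi z)/pi and divide by the function; the
  reciprocal Gamma function is entire, so the product is free of poles.\<close>

lemma Digamma_reflection_complex:
  fixes z :: complex
  assumes z: "z \<notin> \<int>"
  shows "Digamma (1 - z) - Digamma z = of_real pi * cos (of_real pi * z) / sin (of_real pi * z)"
proof -
  have z': "z \<notin> \<int>\<^sub>\<le>\<^sub>0" "1 - z \<notin> \<int>\<^sub>\<le>\<^sub>0"
    using z nonpos_Ints_Int Ints_diff[of 1 "1 - z"] by auto
  have refl: "(\<lambda>z. rGamma z * rGamma (1 - z)) = (\<lambda>z :: complex. sin (of_real pi * z) / of_real pi)"
    using rGamma_reflection_complex by auto
  have "((\<lambda>z. rGamma z * rGamma (1 - z)) has_field_derivative
           rGamma z * rGamma (1 - z) * (Digamma (1 - z) - Digamma z)) (at z)"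
    using z' by (auto intro!: derivative_eq_intros simp: algebra_simps)
  hence "((\<lambda>z. sin (of_real pi * z) / of_real pi) has_field_derivative
           sin (of_real pi * z) / of_real pi * (Digamma (1 - z) - Digamma z)) (at z)"
    unfolding refl using fun_cong[OF refl, of z] by simp
  moreover have "((\<lambda>z. sin (of_real pi * z) / of_real pi) has_field_derivative cos (of_real pi * z)) (at z)"
    by (auto intro!: derivative_eq_intros)
  ultimately have "sin (of_real pi * z) / of_real pi * (Digamma (1 - z) - Digamma z) = cos (of_real pi * z)"
    by (rule DERIV_unique)
  moreover have "sin (of_real pi * z) \<noteq> 0"
    using z by (auto simp: sin_eq_0)
  ultimately show ?thesis
    by (simp add: field_simps)
qed

text \<open>The terms 1/(n+1) and the Euler constant cancel between the two digamma series.\<close>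

lemma Digamma_diff_sums:
  fixes w z :: complex
  assumes "w \<noteq> 0" "z \<noteq> 0"
  shows "(\<lambda>n. inverse (z + of_nat n) - inverse (w + of_nat n)) sums (Digamma w - Digamma z)"
  using sums_diff[OF summable_sums[OF summable_Digamma[OF assms(1)]] summable_sums[OF summable_Digamma[OF assms(2)]]]
  by (simp add: Digamma_def)

text \<open>Splitting a/(a^2-u^2) into 1/(a+u) and 1/(a-u) gives digamma values at (1+-u)/4 and
  (3+-u)/4. Reflection turns them into pi (cot \<alpha> + tan \<alpha>) = 2 pi / sin(2 \<alpha>),
  where sin(2 \<alpha>) = cos(pi u/2). Consecutive terms are paired so that digamma differences
  appear.\<close>

lemma secant_partial_fractions:
  fixes u :: complex
  assumes u: "Im u \<noteq> 0"
  shows "(\<lambda>k. (4 * of_nat k + 1) / ((4 * of_nat k + 1)\<^sup>2 - u\<^sup>2) - (4 * of_nat k + 3) / ((4 * of_nat k + 3)\<^sup>2 - u\<^sup>2))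
           sums (of_real pi / 4 / cos (of_real pi * u / 2))"
proof -
  have nz: "of_real a + u \<noteq> 0" "of_real a - u \<noteq> 0" for a :: real
    using u by (auto simp: complex_eq_iff)
  have nint: "(1 + u) / 4 \<notin> \<int>" "(1 - u) / 4 \<notin> \<int>"
    using u by (auto elim!: Ints_cases simp: complex_eq_iff)
  define \<alpha> where "\<alpha> = of_real pi * ((1 + u) / 4)"
  have \<alpha>': "of_real pi * ((1 - u) / 4) = of_real pi / 2 - \<alpha>"
    by (simp add: \<alpha>_def field_simps)
  have nz': "sin \<alpha> \<noteq> 0" "cos \<alpha> \<noteq> 0"
    unfolding \<alpha>_def sin_eq_0 cos_eq_0 using u by (auto simp: complex_eq_iff)
  have "2 * \<alpha> = of_real pi / 2 - (- (of_real pi * u / 2))"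
    by (simp add: \<alpha>_def field_simps)
  hence sin2: "2 * sin \<alpha> * cos \<alpha> = cos (of_real pi * u / 2)"
    by (metis sin_double cos_sin_eq cos_minus mult.assoc)
  have "(\<lambda>k. inverse ((1 + u) / 4 + of_nat k) - inverse ((3 + u) / 4 + of_nat k)
            + (inverse ((1 - u) / 4 + of_nat k) - inverse ((3 - u) / 4 + of_nat k)))
         sums (Digamma ((3 + u) / 4) - Digamma ((1 + u) / 4) + (Digamma ((3 - u) / 4) - Digamma ((1 - u) / 4)))"
    using u by (intro sums_add Digamma_diff_sums) (auto simp: complex_eq_iff)
  also have "Digamma ((3 + u) / 4) - Digamma ((1 + u) / 4) + (Digamma ((3 - u) / 4) - Digamma ((1 - u) / 4))
       = (Digamma (1 - (1 + u) / 4) - Digamma ((1 + u) / 4)) + (Digamma (1 - (1 - u) / 4) - Digamma ((1 - u) / 4))"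
  proof -
    have "1 - (1 + u) / 4 = (3 - u) / 4" "1 - (1 - u) / 4 = (3 + u) / 4"
      by (simp_all add: field_simps)
    thus ?thesis unfolding \<open>1 - (1 + u) / 4 = _\<close> \<open>1 - (1 - u) / 4 = _\<close> by simp
  qed
  also have "\<dots> = of_real pi * (cos \<alpha> / sin \<alpha> + sin \<alpha> / cos \<alpha>)"
    unfolding Digamma_reflection_complex[OF nint(1)] Digamma_reflection_complex[OF nint(2)] \<alpha>' \<alpha>_def[symmetric]
    by (simp add: cos_diff sin_diff cos_of_real_pi_half sin_of_real_pi_half algebra_simps)
  also have "\<dots> = of_real pi * (1 / (sin \<alpha> * cos \<alpha>))"
  proof -
    have "cos \<alpha> / sin \<alpha> + sin \<alpha> / cos \<alpha> = ((sin \<alpha>)\<^sup>2 + (cos \<alpha>)\<^sup>2) / (sin \<alpha> * cos \<alpha>)"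
      using nz' by (simp add: field_simps power2_eq_square)
    thus ?thesis by (simp only: sin_cos_squared_add)
  qed
  also have "\<dots> = 8 * (of_real pi / 4 / cos (of_real pi * u / 2))"
    unfolding sin2[symmetric] by simp
  finally have "(\<lambda>k. 1 / 8 * (inverse ((1 + u) / 4 + of_nat k) - inverse ((3 + u) / 4 + of_nat k)
            + (inverse ((1 - u) / 4 + of_nat k) - inverse ((3 - u) / 4 + of_nat k))))
      sums (1 / 8 * (8 * (of_real pi / 4 / cos (of_real pi * u / 2))))"
    by (rule sums_mult)
  moreover have summand: "1 / 8 * (inverse ((1 + u) / 4 + of_nat k) - inverse ((3 + u) / 4 + of_nat k)
            + (inverse ((1 - u) / 4 + of_nat k) - inverse ((3 - u) / 4 + of_nat k)))
     = (4 * of_nat k + 1) / ((4 * of_nat k + 1)\<^sup>2 - u\<^sup>2) - (4 * of_nat k + 3) / ((4 * of_nat k + 3)\<^sup>2 - u\<^sup>2)" for k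
  proof -
    have pair: "1 / 8 * (inverse ((a + u) / 4 + of_nat k) + inverse ((a - u) / 4 + of_nat k))
            = (4 * of_nat k + a) / ((4 * of_nat k + a)\<^sup>2 - u\<^sup>2)" 
      if "4 * of_nat k + a + u \<noteq> 0" "4 * of_nat k + a - u \<noteq> 0" for a
    proof -
      have 1: "(a + u) / 4 + of_nat k = (4 * of_nat k + a + u) / 4"
         "(a - u) / 4 + of_nat k = (4 * of_nat k + a - u) / 4"
        by (simp_all add: field_simps)
      have 2: "(4 * of_nat k + a)\<^sup>2 - u\<^sup>2 = (4 * of_nat k + a + u) * (4 * of_nat k + a - u)"
        by (simp add: power2_eq_square algebra_simps)
      have "1 / 8 * (inverse (x / 4) + inverse (y / 4)) = (x + y) / 2 / (x * y)" 
        if "x \<noteq> 0" "y \<noteq> 0" for x y :: complex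
        using that by (simp add: field_simps)
      moreover have "(4 * of_nat k + a + u + (4 * of_nat k + a - u)) / 2 = 4 * of_nat k + a"
        by simp
      ultimately show ?thesis unfolding 1 2 using that by metis
    qed
    have "4 * of_nat k + 1 + u \<noteq> 0" "4 * of_nat k + 1 - u \<noteq> 0"
      "4 * of_nat k + 3 + u \<noteq> 0" "4 * of_nat k + 3 - u \<noteq> 0"
      using nz[of "4 * real k + 1"] nz[of "4 * real k + 3"] by simp_all
    from pair[OF this(1,2)] pair[OF this(3,4)] show ?thesis
      by (simp only: ring_distribs add_diff_eq diff_diff_eq) (simp add: algebra_simps)
  qed
  ultimately show ?thesis unfolding summand by simp
qed

section \<open>The Laplace transform of the eta cube\<close>

lemma eta_cubed_laplace_transform:
  fixes s u :: complex
  assumes s: "Re s > 0" and u: "Im u \<noteq> 0" "u\<^sup>2 = - s"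
  shows "((\<lambda>x. of_real (eta_im (4 * x / pi) ^ 3) * exp (- s * of_real x)) has_integral
            of_real pi / 4 / cos (of_real pi * u / 2)) {0<..}"
proof (rule has_integral_dominated_convergence)
  define t where "t n x = (-1) ^ n * (2 * real n + 1) * exp (- (2 * real n + 1)\<^sup>2 * x)" for n x
  define y where "y n = (-1) ^ n * (2 * of_nat n + 1) / ((2 * of_nat n + 1)\<^sup>2 + s)" for n :: nat
  have "((\<lambda>x. of_real (t n x) * exp (- s * of_real x)) has_integral y n) {0<..}" for n
  proof -
    let ?w = "(2 * of_nat n + 1)\<^sup>2 + s"
    have "(2 * of_nat n + 1 :: complex)\<^sup>2 = of_real ((2 * real n + 1)\<^sup>2)"
      by simp
    hence "Re ?w > 0"
      using s by (simp only: plus_complex.sel Re_complex_of_real) (simp add: add_nonneg_pos)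
    hence "((\<lambda>x. (-1) ^ n * (2 * of_nat n + 1) * exp (- ?w * of_real x)) has_integral
        (-1) ^ n * (2 * of_nat n + 1) * (1 / ?w)) {0<..}"
      by (intro has_integral_mult_right has_integral_exp_minus_complex)
    moreover have "(-1) ^ n * (2 * of_nat n + 1) * exp (- ?w * of_real x) = of_real (t n x) * exp (- s * of_real x)" for x
      by (simp add: t_def exp_of_real[symmetric] algebra_simps flip: exp_add)
    ultimately show ?thesis
      by (simp add: y_def)
  qed
  \<comment> \<open>Only partial sums of even length are used, to match the paired series for the
    secant.\<close>
  thus "((\<lambda>x. (\<Sum>n<2 * N. of_real (t n x) * exp (- s * of_real x))) has_integral (\<Sum>n<2 * N. y n)) {0<..}" for N
    by (intro has_integral_sum) auto
  show "(\<lambda>x. 2 * (exp (- Re s * x) / sqrt x)) integrable_on {0<..}"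
    using s by (intro integrable_on_mult_right inverse_sqrt_exp_integrable)
  have factor: "(\<Sum>n<N. of_real (t n x) * exp (- s * of_real x)) = of_real (\<Sum>n<N. t n x) * exp (- s * of_real x)" for N x
    by (simp add: sum_distrib_right)
  show "\<forall>x\<in>{0<..}. norm (\<Sum>n<2 * N. of_real (t n x) * exp (- s * of_real x)) \<le> 2 * (exp (- Re s * x) / sqrt x)" for N
  proof
    fix x :: real assume "x \<in> {0<..}"
    hence "\<bar>\<Sum>n<2 * N. t n x\<bar> * exp (- Re s * x) \<le> 2 / sqrt x * exp (- Re s * x)"
      unfolding t_def by (intro mult_right_mono theta_partial_sum_bound) auto
    thus "norm (\<Sum>n<2 * N. of_real (t n x) * exp (- s * of_real x)) \<le> 2 * (exp (- Re s * x) / sqrt x)"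
      unfolding factor by (simp add: norm_mult del: of_real_sum)
  qed
  have even: "filterlim (\<lambda>N::nat. 2 * N) sequentially sequentially"
    by (rule filterlim_subseq) (simp add: strict_mono_def)
  show "\<forall>x\<in>{0<..}. (\<lambda>N. \<Sum>n<2 * N. of_real (t n x) * exp (- s * of_real x)) \<longlonglongrightarrow>
          of_real (eta_im (4 * x / pi) ^ 3) * exp (- s * of_real x)"
  proof
    fix x :: real assume "x \<in> {0<..}"
    hence "(\<lambda>n. t n x) sums (eta_im (4 * x / pi) ^ 3)"
      unfolding t_def by (intro eta_im_cubed_sums) auto
    hence "(\<lambda>N. \<Sum>n<2 * N. t n x) \<longlonglongrightarrow> eta_im (4 * x / pi) ^ 3"
      unfolding sums_def by (rule filterlim_compose[OF _ even])
    thus "(\<lambda>N. \<Sum>n<2 * N. of_real (t n x) * exp (- s * of_real x)) \<longlonglongrightarrow>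
          of_real (eta_im (4 * x / pi) ^ 3) * exp (- s * of_real x)"
      unfolding factor by (intro tendsto_intros)
  qed
  \<comment> \<open>Since u^2 = -s, the denominator (2n+1)^2 + s is (2n+1)^2 - u^2; even and odd
    \<open>n\<close> give the residues 1 and 3 modulo 4.\<close>
  have y_even: "y (2 * k) = (4 * of_nat k + 1) / ((4 * of_nat k + 1)\<^sup>2 - u\<^sup>2)" for k
    by (simp add: y_def u)
  have y_odd: "y (Suc (2 * k)) = - ((4 * of_nat k + 3) / ((4 * of_nat k + 3)\<^sup>2 - u\<^sup>2))" for k
  proof -
    have "2 * of_nat (Suc (2 * k)) + 1 = (4 * of_nat k + 3 :: complex)" by simp
    thus ?thesis unfolding y_def by (simp only: u) (simp add: minus_divide_left)
  qed
  have "(\<Sum>n<2 * N. y n) = (\<Sum>k<N. (4 * of_nat k + 1) / ((4 * of_nat k + 1)\<^sup>2 - u\<^sup>2)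
           - (4 * of_nat k + 3) / ((4 * of_nat k + 3)\<^sup>2 - u\<^sup>2))" for N
    by (induction N) (simp_all add: y_even y_odd)
  thus "(\<lambda>N. \<Sum>n<2 * N. y n) \<longlonglongrightarrow> of_real pi / 4 / cos (of_real pi * u / 2)"
    using secant_partial_fractions[OF u(1)] by (simp add: sums_def)
qed

section \<open>Real and imaginary parts\<close>

theorem theorem1p1:
  fixes b c :: real
  assumes "b > 0" and "c > 0"
  shows "((\<lambda>x. eta_im (4 * x / pi) ^ 3 * exp (- (b ^ 2) * x) * sin (c * x)) has_integral
           pi / 4 * (sinh (pi / 2 * A_bc b c) * sin (pi / 2 * B_bc b c)) /
             ((sinh (pi / 2 * A_bc b c))\<^sup>2 + (cos (pi / 2 * B_bc b c))\<^sup>2)) {0<..}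
       \<and> ((\<lambda>x. eta_im (4 * x / pi) ^ 3 * exp (- (b ^ 2) * x) * cos (c * x)) has_integral
           pi / 4 * (cosh (pi / 2 * A_bc b c) * cos (pi / 2 * B_bc b c)) /
             ((cosh (pi / 2 * A_bc b c))\<^sup>2 - (sin (pi / 2 * B_bc b c))\<^sup>2)) {0<..}"
proof -
  define A B where "A = A_bc b c" and "B = B_bc b c"
  define r where "r = sqrt (b ^ 4 + c\<^sup>2)"
  \<comment> \<open>With this sign exp(-sx) = exp(-b^2 x) (cos cx + i sin cx), and u^2 = B^2 - A^2 +
    2iAB = -b^2 + ic = -s.\<close>
  define s where "s = Complex (b\<^sup>2) (- c)"
  define u where "u = Complex B A"
  have r2: "r\<^sup>2 = b ^ 4 + c\<^sup>2"
    by (simp add: r_def)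
  have r: "b\<^sup>2 < r"
    unfolding r_def using assms by (intro real_less_rsqrt) simp
  have r0: "r + b\<^sup>2 > 0" using r assms by (smt (verit) zero_le_power2)
  have A2: "A\<^sup>2 = (r + b\<^sup>2) / 2" and B2: "B\<^sup>2 = (r - b\<^sup>2) / 2"
    using r r0 by (simp_all add: A_def B_def A_bc_def B_bc_def flip: r_def)
  have A0: "A > 0" and B0: "B > 0"
    using r r0 by (simp_all add: A_def B_def A_bc_def B_bc_def flip: r_def)
  have "(2 * A * B)\<^sup>2 = 4 * (A\<^sup>2 * B\<^sup>2)"
    by (simp add: power_mult_distrib)
  also have "\<dots> = r\<^sup>2 - (b\<^sup>2)\<^sup>2"
    unfolding A2 B2 by (simp add: power2_eq_square field_simps)
  also have "\<dots> = c\<^sup>2"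
    by (simp add: r2)
  finally have AB: "2 * A * B = c"
    using A0 B0 assms by (simp add: power2_eq_iff_nonneg)
  have "u\<^sup>2 = - s"
    using AB A2 B2 by (simp add: u_def s_def complex_eq_iff power2_eq_square field_simps)
  hence int: "((\<lambda>x. of_real (eta_im (4 * x / pi) ^ 3) * exp (- s * of_real x)) has_integral
            of_real pi / 4 / cos (of_real pi * u / 2)) {0<..}"
    using A0 assms by (intro eta_cubed_laplace_transform) (simp_all add: s_def u_def)
  define \<alpha> \<beta> where "\<alpha> = pi / 2 * A" and "\<beta> = pi / 2 * B"
  define D where "D = (sinh \<alpha>)\<^sup>2 + (cos \<beta>)\<^sup>2"
  have D': "(cosh \<alpha>)\<^sup>2 - (sin \<beta>)\<^sup>2 = D"
    by (simp add: D_def cosh_square_eq cos_squared_eq)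
  have "of_real pi * u / 2 = Complex \<beta> \<alpha>"
    by (simp add: u_def \<alpha>_def \<beta>_def complex_eq_iff)
  hence cos: "cos (of_real pi * u / 2) = Complex (cos \<beta> * cosh \<alpha>) (- (sin \<beta> * sinh \<alpha>))"
    by (simp add: complex_eq_iff Re_cos Im_cos cosh_def sinh_def exp_minus field_simps)
  \<comment> \<open>\<open>D\<close> is the squared modulus of the cosine. Its reciprocal is the
    conjugate over \<open>D\<close>, which turns the negative imaginary part positive.\<close>
  have "(cos \<beta> * cosh \<alpha>)\<^sup>2 + (sin \<beta> * sinh \<alpha>)\<^sup>2 = D"
    by (simp add: D_def power_mult_distrib cosh_square_eq cos_squared_eq algebra_simps)
  hence inv: "1 / cos (of_real pi * u / 2) = Complex (cosh \<alpha> * cos \<beta> / D) (sinh \<alpha> * sin \<beta> / D)"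
    unfolding cos by (simp add: complex_eq_iff Re_divide Im_divide mult_ac)
  have "of_real pi / 4 / cos (of_real pi * u / 2) = of_real (pi / 4) * (1 / cos (of_real pi * u / 2))"
    by simp
  hence val: "of_real pi / 4 / cos (of_real pi * u / 2) =
      Complex (pi / 4 * (cosh \<alpha> * cos \<beta>) / D) (pi / 4 * (sinh \<alpha> * sin \<beta>) / D)"
    unfolding inv by (simp add: complex_eq_iff)
  have re: "Re (of_real (eta_im (4 * x / pi) ^ 3) * exp (- s * of_real x))
       = eta_im (4 * x / pi) ^ 3 * exp (- (b ^ 2) * x) * cos (c * x)" for x
    by (simp only: Re_complex_of_real Im_complex_of_real times_complex.sel) (simp add: s_def Re_exp)
  have im: "Im (of_real (eta_im (4 * x / pi) ^ 3) * exp (- s * of_real x))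
       = eta_im (4 * x / pi) ^ 3 * exp (- (b ^ 2) * x) * sin (c * x)" for x
    by (simp only: Re_complex_of_real Im_complex_of_real times_complex.sel) (simp add: s_def Im_exp)
  show ?thesis
    using has_integral_linear[OF int bounded_linear_Re] has_integral_linear[OF int bounded_linear_Im]
    unfolding o_def re im val complex.sel
    by (simp only: A_def[symmetric] B_def[symmetric] \<alpha>_def[symmetric] \<beta>_def[symmetric] D' D_def[symmetric])
qed

end
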